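(* The exponential generating function $R_1(z)=\sum_{n\ge0}r_{1,n}\frac{z^n}{n!}$ of relaxed trees of right height at most $1$ is D-finite and satisfies $(1-2z)R_1'(z)-R_1(z)=0$, $R_1(0)=1$. Moreover $R_1(z)=\frac{1}{\sqrt{1-2z}}$ and $r_{1,n}=(2n-1)!!$ for all $n\ge0$.
   Context: $m!!=\prod_{j=0}^{\lfloor (m-1)/2\rfloor}(m-2j)$ (so $(-1)!!=1$). A relaxed tree of size $n$: take a full binary tree $T$ (each node $0$ or $2$ ordered children) with $n$ internal nodes, traverse in post-order (left, right, node); keep the first leaf as the sink and replace every other leaf $\lambda$ by a pointer to a node (internal node or sink) visited before $\lambda$; relaxed trees are equal iff same $T$ and same targets. The spine is the binary tree of internal nodes of $T$ with the tree edges between them; the right height is the maximal number of right edges on a spine path from the root. $r_{1,n}$ counts relaxed trees of size $n$ with right height at most $1$. *)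

theory Defs
  imports
    "HOL-Library.Tree"
    "HOL-Computational_Algebra.Polynomial_FPS"
begin

text \<open>
  A full binary tree is a \<^typ>\<open>unit tree\<close>: \<^const>\<open>Leaf\<close> is a node without
  children, \<^const>\<open>Node\<close> a node with two ordered children, and \<^const>\<open>size\<close> counts
  the internal nodes. A node (leaf or internal) is addressed by the sequence of
  left/right steps leading to it from the root.
\<close>

datatype dir = Lft | Rgt

type_synonym position = "dir list"

primrec leaf_nodes :: "'a tree \<Rightarrow> position set" where
  "leaf_nodes Leaf = {[]}"
| "leaf_nodes (Node l x r) = (#) Lft ` leaf_nodes l \<union> (#) Rgt ` leaf_nodes r"

primrec internal_nodes :: "'a tree \<Rightarrow> position set" where
  "internal_nodes Leaf = {}"
| "internal_nodes (Node l x r) =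
     insert [] ((#) Lft ` internal_nodes l \<union> (#) Rgt ` internal_nodes r)"

text \<open>Unlike \<^const>\<open>postorder\<close>, this traversal also visits the leaves.\<close>

primrec visits :: "'a tree \<Rightarrow> position list" where
  "visits Leaf = [[]]"
| "visits (Node l x r) = map ((#) Lft) (visits l) @ map ((#) Rgt) (visits r) @ [[]]"

definition visited_before :: "'a tree \<Rightarrow> position \<Rightarrow> position \<Rightarrow> bool" where
  "visited_before t p q \<longleftrightarrow>
     (\<exists>i j. i < j \<and> j < length (visits t) \<and> visits t ! i = p \<and> visits t ! j = q)"

definition sink :: "'a tree \<Rightarrow> position" where
  "sink t = hd (filter (\<lambda>p. p \<in> leaf_nodes t) (visits t))"

text \<open>
  The second component maps each pointer (a leaf other than the sink) to its
  target. As the domain is exactly the set of pointers, equality of pairs is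
  equality of the trees and of all targets.
\<close>

type_synonym pointed_tree = "unit tree \<times> (position \<rightharpoonup> position)"

definition relaxed_tree :: "pointed_tree \<Rightarrow> bool" where
  "relaxed_tree = (\<lambda>(t, f).
     dom f = leaf_nodes t - {sink t} \<and>
     (\<forall>p q. f p = Some q \<longrightarrow>
        q \<in> insert (sink t) (internal_nodes t) \<and> visited_before t q p))"

text \<open>
  The spine path from the root to an internal node \<open>p\<close> runs through internal nodes
  only, and its right edges are the \<^const>\<open>Rgt\<close> steps of \<open>p\<close>. The inserted \<open>0\<close>
  matters only for \<^const>\<open>Leaf\<close>, whose spine is empty.
\<close>

definition right_height :: "'a tree \<Rightarrow> nat" where
  "right_height t = Max (insert 0 ((\<lambda>p. count_list p Rgt) ` internal_nodes t))"

definition relaxed_trees :: "nat \<Rightarrow> nat \<Rightarrow> pointed_tree set" where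
  "relaxed_trees k n =
     {(t, f). relaxed_tree (t, f) \<and> size t = n \<and> right_height t \<le> k}"

definition relaxed_count :: "nat \<Rightarrow> nat \<Rightarrow> nat" where
  "relaxed_count k n = card (relaxed_trees k n)"

definition relaxed_egf :: "nat \<Rightarrow> real fps" where
  "relaxed_egf k = Abs_fps (\<lambda>n. of_nat (relaxed_count k n) / fact n)"

definition D_finite :: "'a :: field_char_0 fps \<Rightarrow> bool" where
  "D_finite F \<longleftrightarrow>
     (\<exists>d (p :: nat \<Rightarrow> 'a poly). p d \<noteq> 0 \<and>
        (\<Sum>k\<le>d. fps_of_poly (p k) * (fps_deriv ^^ k) F) = 0)"

text \<open>
  Integer arguments, so that \<open>(- 1)!! = 1\<close> is an empty product rather than a
  truncated subtraction; \<open>div\<close> on \<^typ>\<open>int\<close> is the floor of the quotient.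
\<close>

definition double_factorial :: "int \<Rightarrow> int" where
  "double_factorial m = (\<Prod>j = 0..(m - 1) div 2. m - 2 * j)"

end

theory Submission
  imports Defs "HOL-Library.FuncSet"
begin

text \<open>
  A pointer may target the sink or any internal node visited before it, so a fixed
  tree carries \<open>\<Prod>(1 + number of internal nodes visited before \<lambda>)\<close> relaxed trees, where
  \<open>\<lambda>\<close> may range over all leaves because the sink contributes a factor 1. This weight
  is multiplicative along the root decomposition. In a tree of right height at most 1
  the right subtree of the root is a left chain, and lengthening that chain by one
  node in a tree of size \<open>n\<close> multiplies the weight by \<open>n\<close>. Separating the trees of
  size \<open>n + 1\<close> whose root has a leaf as right child, which contribute \<open>n + 1\<close> times the
  count of size \<open>n\<close>, gives \<open>r (n + 1) = (n + (n + 1)) * r n\<close>.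
\<close>

section \<open>Traversal order\<close>

text \<open>Stated for arbitrary lists, so that rules for \<open>@\<close> and \<open>map\<close>
  follow by list induction; \<open>visits\<close> is built from exactly these two
  operations.\<close>

definition precedes :: "'a list \<Rightarrow> 'a \<Rightarrow> 'a \<Rightarrow> bool" where
  "precedes xs p q \<longleftrightarrow> (\<exists>i j. i < j \<and> j < length xs \<and> xs ! i = p \<and> xs ! j = q)"

lemma visited_before_precedes: "visited_before t = precedes (visits t)"
  by (simp add: visited_before_def precedes_def fun_eq_iff)

lemma precedes_Nil [simp]: "\<not> precedes [] p q"
  by (simp add: precedes_def)

lemma precedes_Cons [simp]:
  "precedes (x # xs) p q \<longleftrightarrow> p = x \<and> q \<in> set xs \<or> precedes xs p q"
proof
  assume "precedes (x # xs) p q"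
  then obtain i j where ij: "i < j" "j < length (x # xs)" "(x # xs) ! i = p" "(x # xs) ! j = q"
    by (auto simp: precedes_def)
  then obtain j' where j': "j = Suc j'" by (cases j) auto
  show "p = x \<and> q \<in> set xs \<or> precedes xs p q"
  proof (cases i)
    case 0
    then show ?thesis using ij j' by auto
  next
    case (Suc i')
    then have "i' < j'" "j' < length xs" "xs ! i' = p" "xs ! j' = q" using ij j' by auto
    then show ?thesis unfolding precedes_def by blast
  qed
next
  assume "p = x \<and> q \<in> set xs \<or> precedes xs p q"
  then show "precedes (x # xs) p q"
  proof
    assume "p = x \<and> q \<in> set xs"
    then obtain j where "j < length xs" "xs ! j = q" "p = x" by (auto simp: in_set_conv_nth)
    then have "0 < Suc j \<and> Suc j < length (x # xs) \<and> (x # xs) ! 0 = p \<and> (x # xs) ! Suc j = q"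
      by simp
    then show ?thesis unfolding precedes_def by blast
  next
    assume "precedes xs p q"
    then obtain i j where "i < j" "j < length xs" "xs ! i = p" "xs ! j = q"
      by (auto simp: precedes_def)
    then have "Suc i < Suc j \<and> Suc j < length (x # xs) \<and> (x # xs) ! Suc i = p \<and> (x # xs) ! Suc j = q"
      by simp
    then show ?thesis unfolding precedes_def by blast
  qed
qed

lemma precedes_append:
  "precedes (xs @ ys) p q \<longleftrightarrow> precedes xs p q \<or> precedes ys p q \<or> p \<in> set xs \<and> q \<in> set ys"
  by (induction xs) auto

lemma precedes_map: "precedes (map g xs) p q \<longleftrightarrow> (\<exists>a b. p = g a \<and> q = g b \<and> precedes xs a b)"
  by (induction xs) auto

lemma set_visits: "set (visits t) = leaf_nodes t \<union> internal_nodes t"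
  by (induction t) auto

lemma leaf_nodes_not_internal: "p \<in> leaf_nodes t \<Longrightarrow> p \<notin> internal_nodes t"
  by (induction t arbitrary: p) auto

lemma finite_leaf_nodes [simp]: "finite (leaf_nodes t)"
  by (induction t) auto

lemma finite_internal_nodes [simp]: "finite (internal_nodes t)"
  by (induction t) auto

lemma card_internal_nodes: "card (internal_nodes t) = size t"
proof (induction t)
  case (Node l x r)
  have "card ((#) Lft ` internal_nodes l \<union> (#) Rgt ` internal_nodes r) = size l + size r"
    by (subst card_Un_disjoint) (auto simp: card_image Node)
  moreover have "[] \<notin> (#) Lft ` internal_nodes l \<union> (#) Rgt ` internal_nodes r" by auto
  ultimately show ?case by simp
qed simp

lemma visited_before_Lft:
  "visited_before (Node l x r) q (Lft # p) \<longleftrightarrow> (\<exists>q'. q = Lft # q' \<and> visited_before l q' p)"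
  by (auto simp: visited_before_precedes precedes_append precedes_map)

lemma visited_before_Rgt:
  assumes "p \<in> set (visits r)"
  shows "visited_before (Node l x r) q (Rgt # p) \<longleftrightarrow>
    (\<exists>q'. q = Lft # q' \<and> q' \<in> set (visits l)) \<or> (\<exists>q'. q = Rgt # q' \<and> visited_before r q' p)"
  using assms by (auto simp: visited_before_precedes precedes_append precedes_map)

lemma sink_Leaf [simp]: "sink Leaf = []"
  by (simp add: sink_def)

text \<open>The left subtree is traversed first and always contains a leaf, so the first leaf is
  found there.\<close>

lemma sink_Node [simp]: "sink (Node l x r) = Lft # sink l"
proof -
  have "filter (\<lambda>p. p \<in> leaf_nodes (Node l x r)) (map ((#) Lft) (visits l)) =
      map ((#) Lft) (filter (\<lambda>p. p \<in> leaf_nodes l) (visits l))"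
    by (auto simp: filter_map o_def intro!: arg_cong[where f = "map _"] filter_cong)
  moreover have "leaf_nodes l \<noteq> {}" by (induction l) auto
  then have "filter (\<lambda>p. p \<in> leaf_nodes l) (visits l) \<noteq> []"
    by (auto simp: filter_empty_conv set_visits)
  ultimately show ?thesis by (simp add: sink_def hd_append hd_map)
qed

lemma sink_in_leaf_nodes: "sink t \<in> leaf_nodes t"
  by (induction t) auto

text \<open>Makes the sink an admissible target of every pointer; this is the extra \<open>1\<close>
  in each factor of the count.\<close>

lemma sink_visited_before: "p \<in> leaf_nodes t \<Longrightarrow> p \<noteq> sink t \<Longrightarrow> visited_before t (sink t) p"
proof (induction t arbitrary: p)
  case (Node l x r)
  consider p' where "p = Lft # p'" "p' \<in> leaf_nodes l" | p' where "p = Rgt # p'" "p' \<in> leaf_nodes r"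
    using Node.prems by auto
  then show ?case
  proof cases
    case 1
    then show ?thesis using Node.IH(1)[of p'] Node.prems by (simp add: visited_before_Lft)
  next
    case 2
    then show ?thesis using sink_in_leaf_nodes[of l] by (simp add: visited_before_Rgt set_visits)
  qed
qed simp

section \<open>Counting the pointer assignments of a tree\<close>

text \<open>The sink is left out so that the cardinalities add up over subtrees.\<close>

definition earlier_nodes :: "'a tree \<Rightarrow> position \<Rightarrow> position set" where
  "earlier_nodes t p = {q \<in> internal_nodes t. visited_before t q p}"

lemma finite_earlier_nodes [simp]: "finite (earlier_nodes t p)"
  by (simp add: earlier_nodes_def)

lemma card_earlier_nodes_Lft:
  "card (earlier_nodes (Node l x r) (Lft # p)) = card (earlier_nodes l p)"
proof -
  have "earlier_nodes (Node l x r) (Lft # p) = (#) Lft ` earlier_nodes l p"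
    by (auto simp: earlier_nodes_def visited_before_Lft)
  then show ?thesis by (simp add: card_image)
qed

text \<open>All of \<open>l\<close> is visited before any leaf of \<open>r\<close>, and the root
  only after both, so the shift is exactly \<open>size l\<close>.\<close>

lemma card_earlier_nodes_Rgt:
  assumes "p \<in> leaf_nodes r"
  shows "card (earlier_nodes (Node l x r) (Rgt # p)) = size l + card (earlier_nodes r p)"
proof -
  have "earlier_nodes (Node l x r) (Rgt # p) =
      (#) Lft ` internal_nodes l \<union> (#) Rgt ` earlier_nodes r p"
    using assms by (auto simp: earlier_nodes_def visited_before_Rgt set_visits)
  moreover have "card \<dots> = size l + card (earlier_nodes r p)"
    by (subst card_Un_disjoint) (auto simp: card_image card_internal_nodes)
  ultimately show ?thesis by simp
qed

lemma earlier_nodes_sink: "card (earlier_nodes t (sink t)) = 0"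
proof (induction t)
  case Leaf
  then show ?case by (simp add: earlier_nodes_def)
next
  case (Node l x r)
  then show ?case by (simp only: sink_Node card_earlier_nodes_Lft)
qed

text \<open>
  The number of pointer assignments when the traversal of \<open>t\<close> starts after \<open>k\<close>
  internal nodes have already been visited, every leaf of \<open>t\<close> being a pointer.
\<close>

primrec weight :: "'a tree \<Rightarrow> nat \<Rightarrow> nat" where
  "weight Leaf k = k + 1"
| "weight (Node l x r) k = weight l k * weight r (k + size l)"

text \<open>The offset \<open>k\<close> is arbitrary in the induction because the right subtree
  starts with \<open>k + size l\<close> nodes already visited.\<close>

lemma weight_eq_prod: "weight t k = (\<Prod>p\<in>leaf_nodes t. k + 1 + card (earlier_nodes t p))"
proof (induction t arbitrary: k)
  case Leaf
  then show ?case by (simp add: earlier_nodes_def)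
next
  case (Node l x r)
  have "(\<Prod>p\<in>leaf_nodes (Node l x r). k + 1 + card (earlier_nodes (Node l x r) p)) =
      (\<Prod>p\<in>(#) Lft ` leaf_nodes l. k + 1 + card (earlier_nodes (Node l x r) p)) *
      (\<Prod>p\<in>(#) Rgt ` leaf_nodes r. k + 1 + card (earlier_nodes (Node l x r) p))"
    by (simp only: leaf_nodes.simps) (rule prod.union_disjoint, auto)
  also have "\<dots> = (\<Prod>p\<in>leaf_nodes l. k + 1 + card (earlier_nodes l p)) *
      (\<Prod>p\<in>leaf_nodes r. k + size l + 1 + card (earlier_nodes r p))"
    by (simp add: prod.reindex card_earlier_nodes_Lft card_earlier_nodes_Rgt add_ac)
  finally show ?case using Node by simp
qed

text \<open>Turns partial maps with a fixed domain into extensional functions, whose number is given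
  by \<open>card_PiE\<close>.\<close>

lemma bij_betw_maps_PiE:
  "bij_betw (\<lambda>f x. if x \<in> A then the (f x) else undefined)
     {f. dom f = A \<and> (\<forall>x y. f x = Some y \<longrightarrow> y \<in> B x)} (Pi\<^sub>E A B)"
  by (rule bij_betw_byWitness[where f' = "\<lambda>g x. if x \<in> A then Some (g x) else None"])
     (fastforce simp: PiE_def Pi_def extensional_def fun_eq_iff dom_def split: if_splits)+

lemma card_maps:
  assumes "finite A"
  shows "card {f. dom f = A \<and> (\<forall>x y. f x = Some y \<longrightarrow> y \<in> B x)} = (\<Prod>x\<in>A. card (B x))"
  using bij_betw_same_card[OF bij_betw_maps_PiE[of A B]] card_PiE[OF assms, of B] by simp

lemma card_pointer_maps: "card {f. relaxed_tree (t, f)} = weight t 0"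
proof -
  let ?P = "leaf_nodes t - {sink t}"
  let ?B = "\<lambda>p. {q \<in> insert (sink t) (internal_nodes t). visited_before t q p}"
  have B: "card (?B p) = 1 + card (earlier_nodes t p)" if "p \<in> ?P" for p
  proof -
    have "?B p = insert (sink t) (earlier_nodes t p)"
      using that sink_visited_before[of p t] by (auto simp: earlier_nodes_def)
    moreover have "sink t \<notin> earlier_nodes t p"
      using leaf_nodes_not_internal[OF sink_in_leaf_nodes] by (auto simp: earlier_nodes_def)
    ultimately show ?thesis by simp
  qed
  have "{f. relaxed_tree (t, f)} = {f. dom f = ?P \<and> (\<forall>p q. f p = Some q \<longrightarrow> q \<in> ?B p)}"
    by (simp add: relaxed_tree_def)
  then have "card {f. relaxed_tree (t, f)} = (\<Prod>p\<in>?P. card (?B p))"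
    using card_maps[of ?P ?B] by simp
  also have "\<dots> = (\<Prod>p\<in>?P. 1 + card (earlier_nodes t p))"
    by (rule prod.cong) (use B in auto)
  also have "\<dots> = (\<Prod>p\<in>leaf_nodes t. 1 + card (earlier_nodes t p))"
    by (subst prod.remove[OF finite_leaf_nodes sink_in_leaf_nodes])
      (simp add: earlier_nodes_sink)
  finally show ?thesis by (simp add: weight_eq_prod)
qed

text \<open>An infinite set has \<open>card\<close> equal to 0, whereas the weight is a product of
  positive factors.\<close>

lemma finite_pointer_maps: "finite {f. relaxed_tree (t, f)}"
proof (rule card_ge_0_finite)
  show "0 < card {f. relaxed_tree (t, f)}"
    by (simp add: card_pointer_maps weight_eq_prod)
qed

section \<open>Trees of bounded right height\<close>

lemma right_height_le_iff: "right_height t \<le> k \<longleftrightarrow> (\<forall>p\<in>internal_nodes t. count_list p Rgt \<le> k)"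
  by (simp add: right_height_def)

lemma right_height_Leaf [simp]: "right_height Leaf = 0"
  by (simp add: right_height_def)

lemma right_height_Node_le_0: "right_height (Node l x r) \<le> 0 \<longleftrightarrow> right_height l \<le> 0 \<and> r = Leaf"
proof -
  have "internal_nodes r = {} \<longleftrightarrow> r = Leaf" by (cases r) auto
  then show ?thesis unfolding right_height_le_iff by (auto simp: ball_Un)
qed

text \<open>The right edge at the root uses up one unit of the bound for \<open>r\<close>.\<close>

lemma right_height_Node_le_Suc:
  "right_height (Node l x r) \<le> Suc k \<longleftrightarrow> right_height l \<le> Suc k \<and> right_height r \<le> k"
  unfolding right_height_le_iff by (simp add: ball_Un)

definition trees :: "nat \<Rightarrow> nat \<Rightarrow> unit tree set" where
  "trees k n = {t. size t = n \<and> right_height t \<le> k}"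

primrec left_chain :: "nat \<Rightarrow> unit tree" where
  "left_chain 0 = Leaf"
| "left_chain (Suc m) = Node (left_chain m) () Leaf"

lemma size_left_chain [simp]: "size (left_chain m) = m"
  by (induction m) auto

lemma right_height_0_iff: "right_height t \<le> 0 \<longleftrightarrow> t = left_chain (size t)"
proof (induction t)
  case (Node l x r)
  show ?case
  proof
    assume "right_height (Node l x r) \<le> 0"
    then show "Node l x r = left_chain (size (Node l x r))"
      using Node by (simp only: right_height_Node_le_0) simp
  next
    assume "Node l x r = left_chain (size (Node l x r))"
    then have "r = Leaf" "l = left_chain (size l)" by auto
    then show "right_height (Node l x r) \<le> 0"
      using Node by (simp only: right_height_Node_le_0)
  qed
qed simp

lemma trees_1_0: "trees 1 0 = {Leaf}"
  by (auto simp: trees_def)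

text \<open>The index \<open>j\<close> is the size of the left subtree. The right subtree has right
  height 0, and its size determines it as a left chain.\<close>

lemma trees_1_Suc:
  "trees 1 (Suc n) = (\<Union>j\<le>n. (\<lambda>l. Node l () (left_chain (n - j))) ` trees 1 j)"
proof (rule set_eqI)
  fix t :: "unit tree"
  show "t \<in> trees 1 (Suc n) \<longleftrightarrow> t \<in> (\<Union>j\<le>n. (\<lambda>l. Node l () (left_chain (n - j))) ` trees 1 j)"
  proof (cases t)
    case (Node l x r)
    have "right_height t \<le> 1 \<longleftrightarrow> right_height l \<le> 1 \<and> r = left_chain (size r)"
      unfolding Node One_nat_def right_height_Node_le_Suc right_height_0_iff ..
    then have "t \<in> trees 1 (Suc n) \<longleftrightarrow>
        size l \<le> n \<and> right_height l \<le> 1 \<and> size r = n - size l \<and> r = left_chain (size r)"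
      using Node by (auto simp: trees_def)
    also have "\<dots> \<longleftrightarrow> size l \<le> n \<and> right_height l \<le> 1 \<and> r = left_chain (n - size l)"
      by auto
    also have "\<dots> \<longleftrightarrow> t \<in> (\<Union>j\<le>n. (\<lambda>l. Node l () (left_chain (n - j))) ` trees 1 j)"
      using Node by (auto simp: trees_def)
    finally show ?thesis .
  qed (auto simp: trees_def)
qed

lemma finite_trees_1: "finite (trees 1 n)"
proof (induction n rule: less_induct)
  case (less n)
  then show ?case by (cases n) (auto simp del: One_nat_def simp: trees_1_0 trees_1_Suc)
qed

section \<open>Recurrence for the counts and its solution by double factorials\<close>

lemma relaxed_count_1_eq: "relaxed_count 1 n = (\<Sum>t\<in>trees 1 n. weight t 0)"
proof -
  have "relaxed_trees 1 n = (SIGMA t:trees 1 n. {f. relaxed_tree (t, f)})"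
    by (auto simp: relaxed_trees_def trees_def)
  then show ?thesis
    by (simp add: relaxed_count_def card_pointer_maps finite_pointer_maps finite_trees_1
        del: One_nat_def)
qed

lemma relaxed_count_1_0: "relaxed_count 1 0 = 1"
  unfolding relaxed_count_1_eq trees_1_0 by simp

lemma relaxed_count_1_Suc_sum:
  "relaxed_count 1 (Suc n) = (\<Sum>j\<le>n. relaxed_count 1 j * weight (left_chain (n - j)) j)"
proof -
  \<comment> \<open>The union is disjoint since \<open>j\<close> can be read off as the size of the
    left subtree.\<close>
  have "(\<Sum>t\<in>trees 1 (Suc n). weight t 0) =
      (\<Sum>j\<le>n. \<Sum>t\<in>(\<lambda>l. Node l () (left_chain (n - j))) ` trees 1 j. weight t 0)"
    unfolding trees_1_Suc
    by (rule sum.UNION_disjoint) (use finite_trees_1 in \<open>auto simp: trees_def\<close>)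
  also have "\<dots> = (\<Sum>j\<le>n. \<Sum>l\<in>trees 1 j. weight l 0 * weight (left_chain (n - j)) j)"
    by (rule sum.cong) (auto simp: sum.reindex inj_on_def trees_def)
  finally show ?thesis by (simp add: relaxed_count_1_eq sum_distrib_right del: One_nat_def)
qed

lemma relaxed_count_1_Suc: "relaxed_count 1 (Suc n) = (2 * n + 1) * relaxed_count 1 n"
proof (cases n)
  case 0
  then show ?thesis
    using relaxed_count_1_Suc_sum[of 0] by simp
next
  case (Suc m)
  \<comment> \<open>The term \<open>j = n\<close> is split off: its right subtree is a single leaf
    of weight \<open>n + 1\<close>.\<close>
  have "relaxed_count 1 (Suc n) =
      (\<Sum>j\<le>m. relaxed_count 1 j * weight (left_chain (n - j)) j) + relaxed_count 1 n * (n + 1)"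
    using relaxed_count_1_Suc_sum[of n] by (simp add: Suc)
  \<comment> \<open>The last leaf of the longer chain comes after \<open>j + (m - j) = m\<close>
    internal nodes, so it contributes the factor \<open>m + 1 = n\<close>, independent of
    \<open>j\<close>.\<close>
  also have "(\<Sum>j\<le>m. relaxed_count 1 j * weight (left_chain (n - j)) j) =
      (\<Sum>j\<le>m. relaxed_count 1 j * weight (left_chain (m - j)) j * n)"
    by (rule sum.cong) (auto simp: Suc Suc_diff_le algebra_simps)
  also have "\<dots> = relaxed_count 1 n * n"
    unfolding Suc relaxed_count_1_Suc_sum[of m] sum_distrib_right ..
  finally show ?thesis by (simp add: algebra_simps)
qed

lemma double_factorial_odd_Suc:
  "double_factorial (2 * int (Suc n) - 1) = (2 * int n + 1) * double_factorial (2 * int n - 1)"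
proof -
  \<comment> \<open>The index 0 carries the new factor; shifting the others by one gives the
    previous double factorial.\<close>
  have "{0..(2 * int (Suc n) - 1 - 1) div 2} = insert 0 {1..int n}" by auto
  then have "double_factorial (2 * int (Suc n) - 1) =
      (2 * int n + 1) * (\<Prod>j = 1..int n. 2 * int (Suc n) - 1 - 2 * j)"
    by (simp add: double_factorial_def)
  also have "(\<Prod>j = 1..int n. 2 * int (Suc n) - 1 - 2 * j) = double_factorial (2 * int n - 1)"
    unfolding double_factorial_def
    by (rule prod.reindex_bij_witness[of _ "\<lambda>j. j + 1" "\<lambda>j. j - 1"]) auto
  finally show ?thesis .
qed

lemma relaxed_count_1_double_factorial:
  "int (relaxed_count 1 n) = double_factorial (2 * int n - 1)"
proof (induction n)
  case 0
  then show ?case unfolding relaxed_count_1_0 by (simp add: double_factorial_def)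
next
  case (Suc n)
  then show ?case unfolding relaxed_count_1_Suc double_factorial_odd_Suc by (simp add: algebra_simps)
qed

section \<open>The generating function\<close>

lemma relaxed_egf_nth: "fps_nth (relaxed_egf k) n = of_nat (relaxed_count k n) / fact n"
  by (simp add: relaxed_egf_def)

lemma relaxed_egf_1_0: "fps_nth (relaxed_egf 1) 0 = 1"
  unfolding relaxed_egf_nth relaxed_count_1_0 by simp

lemma relaxed_egf_1_ode:
  "(1 - 2 * fps_X) * fps_deriv (relaxed_egf 1) - relaxed_egf 1 = 0"
proof (rule fps_ext)
  fix n
  let ?F = "relaxed_egf 1"
  \<comment> \<open>The count recurrence divided by \<open>fact n\<close> is the equation between
    the coefficients of index \<open>n\<close>.\<close>
  have rec: "of_nat (Suc n) * fps_nth ?F (Suc n) = (2 * of_nat n + 1) * fps_nth ?F n"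
    unfolding relaxed_egf_nth relaxed_count_1_Suc fact_Suc by (simp add: divide_simps) (simp add: algebra_simps)
  have "(1 - 2 * fps_X) * fps_deriv ?F = fps_deriv ?F - fps_const 2 * (fps_X * fps_deriv ?F)"
    by (simp add: algebra_simps numeral_fps_const)
  then have "fps_nth ((1 - 2 * fps_X) * fps_deriv ?F) n =
      of_nat (Suc n) * fps_nth ?F (Suc n) - 2 * of_nat n * fps_nth ?F n"
    by (cases n) auto
  then show "fps_nth ((1 - 2 * fps_X) * fps_deriv ?F - ?F) n = fps_nth 0 n"
    using rec by (simp add: algebra_simps)
qed

lemma fps_eq_inverse_sqrt:
  fixes F :: "real fps"
  assumes ode: "(1 - 2 * fps_X) * fps_deriv F - F = 0" and F0: "fps_nth F 0 = 1"
  shows "F = 1 / fps_radical root 2 (1 - 2 * fps_X)"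
proof -
  let ?P = "1 - 2 * fps_X :: real fps"
  define G where "G = fps_radical root 2 ?P"
  have P0: "fps_nth ?P 0 = 1" by simp
  have G2: "G ^ 2 = ?P"
    using power_radical[where r = root and a = ?P and k = 1] P0
    by (simp add: G_def numeral_2_eq_2)
  have G0: "fps_nth G 0 = 1"
    by (simp add: G_def)
  \<comment> \<open>\<open>F ^ 2 * ?P\<close> is a first integral: its derivative is a multiple of
    the left side of the equation.\<close>
  have "fps_deriv (F ^ 2 * ?P) = 2 * F * (?P * fps_deriv F - F)"
    by (simp add: fps_deriv_power power2_eq_square algebra_simps)
  then have "fps_deriv (F ^ 2 * ?P) = 0" using ode by simp
  then have "F ^ 2 * ?P = fps_const (fps_nth (F ^ 2 * ?P) 0)"
    by (simp only: fps_deriv_eq_0_iff)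
  also have "\<dots> = 1" using F0 by (simp add: power2_eq_square)
  finally have "(F * G) ^ 2 = 1" by (simp add: power_mult_distrib G2)
  \<comment> \<open>The constant coefficient 1 selects the sign of the square root.\<close>
  moreover have "F * G \<noteq> - 1"
  proof
    assume "F * G = - 1"
    then have "fps_nth (F * G) 0 = - 1" by simp
    then show False using F0 G0 by simp
  qed
  ultimately have FG: "F * G = 1" by (simp add: power2_eq_1_iff)
  have "F = F * G / G" using G0 by (metis fps_nonzero_nth nonzero_mult_div_cancel_right zero_neq_one)
  then show ?thesis by (simp only: FG) (simp only: G_def)
qed

text \<open>The witness has order 1, with coefficient \<open>- 1\<close> at \<open>F\<close> and
  \<open>p\<close> at its derivative.\<close>

lemma D_finite_first_order:
  assumes "fps_of_poly p * fps_deriv F - F = 0" and "p \<noteq> 0"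
  shows "D_finite F"
  unfolding D_finite_def
  by (rule exI[of _ 1], rule exI[of _ "\<lambda>k. if k = 0 then - 1 else p"])
     (use assms in \<open>simp add: fps_of_poly_uminus\<close>)

theorem mainTheorem8:
  shows "D_finite (relaxed_egf 1)
    \<and> (1 - 2 * fps_X) * fps_deriv (relaxed_egf 1) - relaxed_egf 1 = 0
    \<and> fps_nth (relaxed_egf 1) 0 = 1
    \<and> relaxed_egf 1 = 1 / fps_radical root 2 (1 - 2 * fps_X)
    \<and> (\<forall>n. int (relaxed_count 1 n) = double_factorial (2 * int n - 1))"
proof -
  have "fps_of_poly [:1, - 2 :: real:] = 1 - 2 * fps_X"
    by (simp add: fps_of_poly_pCons numeral_fps_const)
  then have "fps_of_poly [:1, - 2:] * fps_deriv (relaxed_egf 1) - relaxed_egf 1 = 0"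
    using relaxed_egf_1_ode by (simp only:)
  then have "D_finite (relaxed_egf 1)"
    by (rule D_finite_first_order) simp
  then show ?thesis
    using relaxed_egf_1_ode relaxed_egf_1_0 relaxed_count_1_double_factorial
      fps_eq_inverse_sqrt[OF relaxed_egf_1_ode relaxed_egf_1_0]
    by blast
qed

end
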